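(* Let $2\le k<v$ be integers. If there exists a $\mathrm{BIBD}(v,k,1)$ that contains at least one parallel class, then there exists an axial ETF of $v(r+1)$ vectors for $\mathbb{C}^b$, where $r=\frac{v-1}{k-1}$ and $b=\frac{v(v-1)}{k(k-1)}$. Moreover, if there exists a real Hadamard matrix of size $r+1$, this ETF can be chosen to be real, that is, to be an axial ETF of $v(r+1)$ vectors for $\mathbb{R}^b$.
   Context: Let $\mathbb{F}\in\{\mathbb{R},\mathbb{C}\}$. For vectors $\{\varphi_i\}_{i=1}^n$ in $\mathbb{F}^m$, the synthesis operator $\Phi$ is the $m\times n$ matrix whose $i$th column is $\varphi_i$. The sequence is an equiangular tight frame (ETF) for $\mathbb{F}^m$ if every $\varphi_i$ has unit norm, $|\langle\varphi_i,\varphi_j\rangle|$ is constant over all $i\neq j$, and $\Phi\Phi^*=\alpha I$ for some $\alpha>0$ (necessarily $\alpha=\frac nm$). An ETF is axial if the all-ones vector $\mathbf{1}\in\mathbb{F}^n$ lies in the column space of $\Phi^*$ (equivalently $\Phi^*\Phi\mathbf{1}=\frac nm\mathbf{1}$). A $\mathrm{BIBD}(v,k,1)$ with $2\le k<v$ is a $v$-element set $\mathcal{V}$ together with a set $\mathcal{B}$ of $k$-element subsets of $\mathcal{V}$ (called blocks) such that every element of $\mathcal{V}$ lies in the same number $r$ of blocks, and every pair of distinct elements of $\mathcal{V}$ is contained in exactly one block. Necessarily $r=\frac{v-1}{k-1}$, and the number of blocks is $b=\frac{v(v-1)}{k(k-1)}$. A parallel class of a BIBD is a subcollection of its blocks that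 forms a partition of $\mathcal{V}$. A real Hadamard matrix of size $N$ is an $N\times N$ matrix with entries $\pm1$ and orthogonal rows. *)

theory Defs
  imports
    "Jordan_Normal_Form.Schur_Decomposition"
    "Jordan_Normal_Form.VS_Connect"
    "HOL-Analysis.L2_Norm"
    "HOL-Library.Disjoint_Sets"
begin

subsection \<open>Equiangular tight frames\<close>

text \<open>
  A sequence of vectors in \<open>\<F>\<^sup>m\<close> is a list of vectors of dimension \<open>m\<close>, and its synthesis operator
  is \<^term>\<open>mat_of_cols m \<phi>s\<close>.  The definitions are only meant for \<open>\<F>\<close> being \<^typ>\<open>real\<close> or \<^typ>\<open>complex\<close>:
  the type classes alone do not relate \<^const>\<open>conjugate\<close> to \<^const>\<open>norm\<close>.
\<close>

definition is_etf :: "nat \<Rightarrow> 'a :: {conjugatable_field, real_normed_field} vec list \<Rightarrow> bool" where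
  "is_etf m \<phi>s \<longleftrightarrow>
     set \<phi>s \<subseteq> carrier_vec m \<and>
     (\<forall>i < length \<phi>s. L2_set (\<lambda>l. norm (\<phi>s ! i $ l)) {..<m} = 1) \<and>
     (\<exists>c. \<forall>i < length \<phi>s. \<forall>j < length \<phi>s. i \<noteq> j \<longrightarrow> norm (\<phi>s ! i \<bullet>c \<phi>s ! j) = c) \<and>
     (\<exists>\<alpha>::real. \<alpha> > 0 \<and>
        mat_of_cols m \<phi>s * mat_adjoint (mat_of_cols m \<phi>s) = of_real \<alpha> \<cdot>\<^sub>m 1\<^sub>m m)"

definition is_axial_etf :: "nat \<Rightarrow> 'a :: {conjugatable_field, real_normed_field} vec list \<Rightarrow> bool" where
  "is_axial_etf m \<phi>s \<longleftrightarrow>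
     is_etf m \<phi>s \<and>
     vec (length \<phi>s) (\<lambda>_. 1) \<in> vec_space.col_space (length \<phi>s) (mat_adjoint (mat_of_cols m \<phi>s))"

subsection \<open>Block designs\<close>

definition is_bibd :: "nat \<Rightarrow> nat \<Rightarrow> 'p set \<Rightarrow> 'p set set \<Rightarrow> bool" where
  "is_bibd v k V B \<longleftrightarrow>
     2 \<le> k \<and> k < v \<and> finite V \<and> card V = v \<and>
     (\<forall>\<beta>\<in>B. \<beta> \<subseteq> V \<and> card \<beta> = k) \<and>
     (\<exists>r. \<forall>x\<in>V. card {\<beta> \<in> B. x \<in> \<beta>} = r) \<and>
     (\<forall>x\<in>V. \<forall>y\<in>V. x \<noteq> y \<longrightarrow> (\<exists>!\<beta>. \<beta> \<in> B \<and> x \<in> \<beta> \<and> y \<in> \<beta>))"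

definition is_parallel_class :: "'p set \<Rightarrow> 'p set set \<Rightarrow> 'p set set \<Rightarrow> bool" where
  "is_parallel_class V B P \<longleftrightarrow> P \<subseteq> B \<and> partition_on V P"

text \<open>
  The divisions in \<open>r = (v - 1) / (k - 1)\<close> and \<open>b = v (v - 1) / (k (k - 1))\<close> are exact for every
  design, so these parameters may be written with \<^const>\<open>divide\<close> on \<^typ>\<open>nat\<close>.
\<close>

lemma is_bibd_replication:
  assumes "is_bibd v k V B" and x: "x \<in> V"
  shows "card {\<beta> \<in> B. x \<in> \<beta>} * (k - 1) = v - 1"
proof -
  have fV: "finite V" and cV: "card V = v" and k2: "2 \<le> k"
    and BV: "\<And>\<beta>. \<beta> \<in> B \<Longrightarrow> \<beta> \<subseteq> V" and cB: "\<And>\<beta>. \<beta> \<in> B \<Longrightarrow> card \<beta> = k"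
    and U: "\<And>x y. x \<in> V \<Longrightarrow> y \<in> V \<Longrightarrow> x \<noteq> y \<Longrightarrow> \<exists>!\<beta>. \<beta> \<in> B \<and> x \<in> \<beta> \<and> y \<in> \<beta>"
    using assms(1) unfolding is_bibd_def by blast+
  have "B \<subseteq> Pow V" using BV by blast
  then have fB: "finite B" using fV by (meson finite_Pow_iff finite_subset)
  have fb: "finite \<beta>" if "\<beta> \<in> B" for \<beta> using BV[OF that] fV finite_subset by blast
  have un: "V - {x} = (\<Union>\<beta>\<in>{\<beta> \<in> B. x \<in> \<beta>}. \<beta> - {x})"
  proof (intro equalityI subsetI)
    fix y assume "y \<in> V - {x}"
    then obtain \<beta> where "\<beta> \<in> B" "x \<in> \<beta>" "y \<in> \<beta>" "y \<noteq> x" using U[OF x, of y] by blast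
    then show "y \<in> (\<Union>\<beta>\<in>{\<beta> \<in> B. x \<in> \<beta>}. \<beta> - {x})" by blast
  qed (use BV in blast)
  have "card (V - {x}) = (\<Sum>\<beta>\<in>{\<beta> \<in> B. x \<in> \<beta>}. card (\<beta> - {x}))"
    unfolding un
  proof (rule card_UN_disjoint)
    show "\<forall>\<beta>\<in>{\<beta> \<in> B. x \<in> \<beta>}. \<forall>\<gamma>\<in>{\<beta> \<in> B. x \<in> \<beta>}. \<beta> \<noteq> \<gamma> \<longrightarrow> (\<beta> - {x}) \<inter> (\<gamma> - {x}) = {}"
    proof (intro ballI impI)
      fix \<beta> \<gamma> assume *: "\<beta> \<in> {\<beta> \<in> B. x \<in> \<beta>}" "\<gamma> \<in> {\<beta> \<in> B. x \<in> \<beta>}" "\<beta> \<noteq> \<gamma>"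
      show "(\<beta> - {x}) \<inter> (\<gamma> - {x}) = {}"
      proof (rule ccontr)
        assume "\<not> ?thesis"
        then obtain y where y: "y \<in> \<beta>" "y \<in> \<gamma>" "x \<noteq> y" by blast
        then have "y \<in> V" using * BV by blast
        from U[OF x this y(3)] * y show False by blast
      qed
    qed
  qed (use fB fb in auto)
  also have "\<dots> = (\<Sum>\<beta>\<in>{\<beta> \<in> B. x \<in> \<beta>}. k - 1)"
    by (rule sum.cong) (auto simp: cB fb)
  finally show ?thesis using x fV cV by simp
qed

lemma is_bibd_replication_number:
  assumes "is_bibd v k V B" and "x \<in> V"
  shows "card {\<beta> \<in> B. x \<in> \<beta>} = (v - 1) div (k - 1)" and "(k - 1) dvd (v - 1)"
proof -
  have "k - 1 > 0" using assms(1) unfolding is_bibd_def by auto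
  with is_bibd_replication[OF assms]
  show "card {\<beta> \<in> B. x \<in> \<beta>} = (v - 1) div (k - 1)" "(k - 1) dvd (v - 1)"
    by (metis nonzero_mult_div_cancel_right less_not_refl, metis dvd_triv_right)
qed

lemma is_bibd_number_of_blocks:
  assumes D: "is_bibd v k V B"
  shows "card B = (v * (v - 1)) div (k * (k - 1))" and "(k * (k - 1)) dvd (v * (v - 1))"
proof -
  have fV: "finite V" and cV: "card V = v" and k2: "2 \<le> k"
    and BV: "\<And>\<beta>. \<beta> \<in> B \<Longrightarrow> \<beta> \<subseteq> V" and cB: "\<And>\<beta>. \<beta> \<in> B \<Longrightarrow> card \<beta> = k"
    using D unfolding is_bibd_def by blast+
  have "B \<subseteq> Pow V" using BV by blast
  then have fB: "finite B" using fV by (meson finite_Pow_iff finite_subset)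
  have "card B * k * (k - 1) = (\<Sum>\<beta>\<in>B. card {x \<in> V. x \<in> \<beta>}) * (k - 1)"
  proof -
    have "{x \<in> V. x \<in> \<beta>} = \<beta>" if "\<beta> \<in> B" for \<beta> using BV[OF that] by blast
    then have "(\<Sum>\<beta>\<in>B. card {x \<in> V. x \<in> \<beta>}) = (\<Sum>\<beta>\<in>B. k)"
      by (intro sum.cong) (auto simp: cB)
    then show ?thesis by simp
  qed
  also have "\<dots> = (\<Sum>x\<in>V. card {\<beta> \<in> B. x \<in> \<beta>}) * (k - 1)"
    using sum_card_image sum.swap[of "\<lambda>\<beta> x. if x \<in> \<beta> then 1 else (0::nat)" V B] fV fB
    by (simp add: sum.If_cases Int_def)
  also have "\<dots> = (\<Sum>x\<in>V. v - 1)"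
    using is_bibd_replication[OF D] by (simp add: sum_distrib_right)
  finally have eq: "card B * (k * (k - 1)) = v * (v - 1)" using cV by (simp add: mult.assoc)
  moreover have "k * (k - 1) \<noteq> 0" using k2 by simp
  ultimately show "card B = (v * (v - 1)) div (k * (k - 1))" "(k * (k - 1)) dvd (v * (v - 1))"
    by (metis nonzero_mult_div_cancel_right, metis dvd_triv_right)
qed

subsection \<open>Hadamard matrices\<close>

definition is_real_hadamard :: "nat \<Rightarrow> real mat \<Rightarrow> bool" where
  "is_real_hadamard N H \<longleftrightarrow>
     H \<in> carrier_mat N N \<and>
     (\<forall>i < N. \<forall>j < N. H $$ (i, j) = 1 \<or> H $$ (i, j) = -1) \<and>
     (\<forall>i < N. \<forall>j < N. i \<noteq> j \<longrightarrow> row H i \<bullet> row H j = 0)"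

end

theory Submission
  imports Defs "HOL-Combinatorics.Transposition"
begin

text \<open>
  Steiner construction. Let \<open>h\<close> be an \<open>(r + 1) \<times> (r + 1)\<close> Hadamard matrix whose row \<open>0\<close> is
  constant \<open>1\<close>. For each point \<open>x\<close>, number the \<open>r\<close> blocks through \<open>x\<close> by \<open>0, \<dots>, r - 1\<close>, and let the
  \<open>(r + 1)\<close> vectors attached to \<open>x\<close> have, in the coordinates of these blocks, the entries of the
  corresponding rows of \<open>h\<close>, divided by \<open>\<surd>r\<close>; the row \<open>r\<close> of \<open>h\<close> is left out. Two vectors at the
  same point have inner product of modulus \<open>1 / r\<close> because only one row of \<open>h\<close> is missing, and two
  vectors at different points because exactly one block contains both points. For axiality the
  numbering gives the number \<open>0\<close> to the block of the parallel class through \<open>x\<close>: then the rows of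
  the synthesis operator indexed by the parallel class add up to a multiple of the all-ones vector.
\<close>

subsection \<open>Fields with a compatible conjugation\<close>

text \<open>Ties conjugation to the norm, so that the construction runs once for \<open>real\<close>
  and \<open>complex\<close> together. The right-hand side of the axiom is \<open>of_real\<close>
  unfolded.\<close>

class normed_conjugatable_field = conjugatable_field + real_normed_field +
  assumes mult_conjugate_scaleR: "x * conjugate x = scaleR (norm x * norm x) 1"

instance real :: normed_conjugatable_field
  by standard simp

instance complex :: normed_conjugatable_field
  by standard (simp add: complex_norm_square[symmetric] scaleR_conv_of_real power2_eq_square[symmetric]
      del: of_real_power)

lemma mult_conjugate:
  "x * conjugate x = of_real ((norm x)\<^sup>2)" for x :: "'a :: normed_conjugatable_field"
  by (simp only: mult_conjugate_scaleR of_real_def power2_eq_square)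

lemma norm_conjugate [simp]: "norm (conjugate (x :: 'a :: normed_conjugatable_field)) = norm x"
proof (cases "x = 0")
  case False
  have "norm (x * conjugate x) = (norm x)\<^sup>2"
    unfolding mult_conjugate by (simp del: of_real_power)
  then show ?thesis using False by (simp add: norm_mult power2_eq_square)
qed simp

text \<open>For nonzero \<open>t\<close>, multiplying by \<open>of_real t\<close> turns both sides
  into the square of \<open>t\<close> by \<open>mult_conjugate\<close>, and the factor
  cancels.\<close>

lemma conjugate_of_real [simp]:
  "conjugate (of_real t :: 'a :: normed_conjugatable_field) = of_real t"
proof (cases "t = 0")
  case False
  have "(of_real t :: 'a) * conjugate (of_real t) = of_real t * of_real t"
    unfolding mult_conjugate by (simp add: power2_eq_square)
  then show ?thesis using False by simp
qed simp

lemma conjugate_one [simp]: "conjugate (1 :: 'a :: normed_conjugatable_field) = 1"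
  using conjugate_of_real[of 1] by simp

lemma mult_conjugate_unit:
  "norm (x :: 'a :: normed_conjugatable_field) = 1 \<Longrightarrow> x * conjugate x = 1"
  by (simp add: mult_conjugate)

subsection \<open>Frames indexed by finite sets\<close>

text \<open>Interface between sums over finite index sets and the lists and matrices of
  \<open>is_axial_etf\<close>, so that a frame can be indexed by points and blocks directly. The
  coefficients \<open>d\<close> witness axiality.\<close>

lemma axial_etf_of_family:
  fixes \<phi> :: "'i \<Rightarrow> 'l \<Rightarrow> 'a :: normed_conjugatable_field"
  assumes I: "finite I" and L: "finite L"
    and unit: "\<And>i. i \<in> I \<Longrightarrow> (\<Sum>l\<in>L. (norm (\<phi> i l))\<^sup>2) = 1"
    and equi: "\<And>i j. i \<in> I \<Longrightarrow> j \<in> I \<Longrightarrow> i \<noteq> j \<Longrightarrow>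
      norm (\<Sum>l\<in>L. \<phi> i l * conjugate (\<phi> j l)) = c"
    and "\<alpha> > 0"
    and tight: "\<And>l m. l \<in> L \<Longrightarrow> m \<in> L \<Longrightarrow>
      (\<Sum>i\<in>I. \<phi> i l * conjugate (\<phi> i m)) = (if l = m then of_real \<alpha> else 0)"
    and axial: "\<And>i. i \<in> I \<Longrightarrow> (\<Sum>l\<in>L. conjugate (\<phi> i l) * d l) = 1"
  shows "\<exists>\<phi>s :: 'a vec list. length \<phi>s = card I \<and> is_axial_etf (card L) \<phi>s"
proof -
  define n m where "n = card I" and "m = card L"
  obtain e where e: "bij_betw e {..<n} I"
    using ex_bij_betw_nat_finite[OF I] by (auto simp: n_def atLeast0LessThan)
  obtain f where f: "bij_betw f {..<m} L"
    using ex_bij_betw_nat_finite[OF L] by (auto simp: m_def atLeast0LessThan)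
  have eI: "e p \<in> I" if "p < n" for p using e that by (auto dest: bij_betwE)
  have fL: "f q \<in> L" if "q < m" for q using f that by (auto dest: bij_betwE)
  have e_eq: "e p = e q \<longleftrightarrow> p = q" if "p < n" "q < n" for p q
    using e that by (auto simp: bij_betw_def inj_on_def)
  have f_eq: "f p = f q \<longleftrightarrow> p = q" if "p < m" "q < m" for p q
    using f that by (auto simp: bij_betw_def inj_on_def)
  have sumL: "(\<Sum>q<m. g (f q)) = sum g L" for g :: "'l \<Rightarrow> 'b :: comm_monoid_add"
    by (rule sum.reindex_bij_betw[OF f])
  have sumI: "(\<Sum>p<n. g (e p)) = sum g I" for g :: "'i \<Rightarrow> 'b :: comm_monoid_add"
    by (rule sum.reindex_bij_betw[OF e])
  define \<phi>s where "\<phi>s = map (\<lambda>p. vec m (\<lambda>q. \<phi> (e p) (f q))) [0..<n]"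
  define \<Phi> where "\<Phi> = mat_of_cols m \<phi>s"
  have len: "length \<phi>s = n" by (simp add: \<phi>s_def)
  have nth: "\<phi>s ! p = vec m (\<lambda>q. \<phi> (e p) (f q))" if "p < n" for p
    using that by (simp add: \<phi>s_def)
  have \<Phi>: "\<Phi> \<in> carrier_mat m n" by (simp add: \<Phi>_def len mat_of_cols_def)
  have \<Phi>_nth: "\<Phi> $$ (q, p) = \<phi> (e p) (f q)" if "q < m" "p < n" for p q
    using that by (simp add: \<Phi>_def mat_of_cols_def len nth)
  have adj: "mat_adjoint \<Phi> = mat n m (\<lambda>(p, q). conjugate (\<phi> (e p) (f q)))"
    using \<Phi> by (auto simp: mat_adjoint_def mat_of_rows_def \<Phi>_nth intro!: eq_matI)
  have "is_etf m \<phi>s"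
    unfolding is_etf_def len \<Phi>_def[symmetric]
  proof (intro conjI allI impI exI)
    show "set \<phi>s \<subseteq> carrier_vec m" by (auto simp: \<phi>s_def)
    show "L2_set (\<lambda>l. norm (\<phi>s ! p $ l)) {..<m} = 1" if "p < n" for p
      using unit[OF eI[OF that]] by (simp add: L2_set_def nth that sumL[of "\<lambda>l. (norm (\<phi> (e p) l))\<^sup>2"])
    show "norm (\<phi>s ! p \<bullet>c \<phi>s ! q) = c" if "p < n" "q < n" "p \<noteq> q" for p q
      using equi[OF eI[OF that(1)] eI[OF that(2)]] that
      by (simp add: scalar_prod_def nth e_eq atLeast0LessThan
          sumL[of "\<lambda>l. \<phi> (e p) l * conjugate (\<phi> (e q) l)"])
    show "\<Phi> * mat_adjoint \<Phi> = of_real \<alpha> \<cdot>\<^sub>m 1\<^sub>m m"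
    proof (rule eq_matI)
      fix q q' assume "q < dim_row (of_real \<alpha> \<cdot>\<^sub>m 1\<^sub>m m :: 'a mat)"
        "q' < dim_col (of_real \<alpha> \<cdot>\<^sub>m 1\<^sub>m m :: 'a mat)"
      then have q: "q < m" "q' < m" by auto
      have "(\<Phi> * mat_adjoint \<Phi>) $$ (q, q') = (\<Sum>p<n. \<phi> (e p) (f q) * conjugate (\<phi> (e p) (f q')))"
        using q \<Phi> by (simp add: adj scalar_prod_def \<Phi>_nth atLeast0LessThan)
      also have "\<dots> = (if q = q' then of_real \<alpha> else 0)"
        using tight[OF fL[OF q(1)] fL[OF q(2)]] q
        by (simp add: sumI[of "\<lambda>i. \<phi> i (f q) * conjugate (\<phi> i (f q'))"] f_eq)
      finally show "(\<Phi> * mat_adjoint \<Phi>) $$ (q, q') = (of_real \<alpha> \<cdot>\<^sub>m 1\<^sub>m m) $$ (q, q')"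
        using q by simp
    qed (use \<Phi> in \<open>auto simp: adj\<close>)
  qed fact
  moreover have "vec n (\<lambda>_. 1) \<in> vec_space.col_space n (mat_adjoint \<Phi>)"
  proof -
    have "mat_adjoint \<Phi> \<in> carrier_mat n m" by (simp add: adj)
    \<comment> \<open>The column space is the range of the matrix, so a preimage of the all-ones
      vector suffices.\<close>
    moreover have "mat_adjoint \<Phi> *\<^sub>v vec m (\<lambda>q. d (f q)) = vec n (\<lambda>_. 1)"
    proof (rule eq_vecI)
      fix p assume "p < dim_vec (vec n (\<lambda>_. 1 :: 'a))"
      then have p: "p < n" by simp
      have "(mat_adjoint \<Phi> *\<^sub>v vec m (\<lambda>q. d (f q))) $ p
        = (\<Sum>q<m. conjugate (\<phi> (e p) (f q)) * d (f q))"
        using p by (simp add: adj scalar_prod_def atLeast0LessThan)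
      also have "\<dots> = 1"
        using axial[OF eI[OF p]] by (simp add: sumL[of "\<lambda>l. conjugate (\<phi> (e p) l) * d l"])
      finally show "(mat_adjoint \<Phi> *\<^sub>v vec m (\<lambda>q. d (f q))) $ p = vec n (\<lambda>_. 1) $ p"
        using p by simp
    qed (simp add: adj)
    ultimately show ?thesis
      by (subst vec_space.col_space_eq[of _ n m]) (auto simp: adj intro!: bexI[of _ "vec m (\<lambda>q. d (f q))"])
  qed
  ultimately show ?thesis
    unfolding is_axial_etf_def \<Phi>_def using len by (auto simp: n_def m_def)
qed

subsection \<open>Complex Hadamard matrices\<close>

text \<open>Row orthogonality makes the adjoint divided by \<open>N\<close> a right inverse. For
  square matrices it is then also a left inverse, and the off-diagonal entries of that product are
  the inner products of columns.\<close>

lemma hadamard_columns_orthogonal: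
  fixes h :: "nat \<Rightarrow> nat \<Rightarrow> 'a :: normed_conjugatable_field"
  assumes "N > 0"
    and h1: "\<And>i j. i < N \<Longrightarrow> j < N \<Longrightarrow> norm (h i j) = 1"
    and rows: "\<And>i i'. i < N \<Longrightarrow> i' < N \<Longrightarrow> i \<noteq> i' \<Longrightarrow> (\<Sum>j<N. h i j * conjugate (h i' j)) = 0"
    and j: "j < N" "j' < N" "j \<noteq> j'"
  shows "(\<Sum>i<N. h i j * conjugate (h i j')) = 0"
proof -
  define A where "A = mat N N (\<lambda>(i, j). h i j)"
  define B where "B = mat N N (\<lambda>(j, i). conjugate (h i j) / of_nat N)"
  have "A * B = 1\<^sub>m N"
  proof (rule eq_matI)
    fix i i' assume "i < dim_row (1\<^sub>m N :: 'a mat)" "i' < dim_col (1\<^sub>m N :: 'a mat)"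
    then have i: "i < N" "i' < N" by auto
    then have "(A * B) $$ (i, i') = (\<Sum>j<N. h i j * conjugate (h i' j)) / of_nat N"
      by (simp add: A_def B_def scalar_prod_def atLeast0LessThan sum_divide_distrib)
    also have "\<dots> = (if i = i' then 1 else 0)"
      using rows[OF i] \<open>N > 0\<close> by (simp add: mult_conjugate_unit h1 i)
    finally show "(A * B) $$ (i, i') = 1\<^sub>m N $$ (i, i')" using i by simp
  qed (auto simp: A_def B_def)
  then have "B * A = 1\<^sub>m N"
    using mat_mult_left_right_inverse[of A N B] by (simp add: A_def B_def)
  then have "(B * A) $$ (j', j) = 0" using j by simp
  also have "(B * A) $$ (j', j) = (\<Sum>i<N. h i j * conjugate (h i j')) / of_nat N"
    using j by (simp add: A_def B_def scalar_prod_def atLeast0LessThan sum_divide_distrib mult.commute)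
  finally show ?thesis using \<open>N > 0\<close> by simp
qed

text \<open>The Fourier matrix serves as a complex Hadamard matrix of every size. The inner product
  of two rows is a geometric sum whose ratio \<open>z\<close> is an \<open>N\<close>-th root of
  unity other than 1.\<close>

lemma fourier_rows_orthogonal:
  assumes i: "i < N" "i' < N" "i \<noteq> i'"
  shows "(\<Sum>j<N. cis (2 * pi * real i / real N) ^ j * conjugate (cis (2 * pi * real i' / real N) ^ j)) = 0"
proof -
  have N: "N > 0" using i by simp
  define w where "w = (\<lambda>i. cis (2 * pi * real i / real N))"
  have bij: "bij_betw w {..<N} {z. z ^ N = 1}"
    unfolding w_def by (rule bij_betw_roots_unity[OF N])
  define z where "z = w i * cnj (w i')"
  have w1: "w i' * cnj (w i') = 1" by (simp add: w_def cis_cnj cis_mult)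
  have wN: "w k ^ N = 1" if "k < N" for k using bij that by (auto dest: bij_betwE)
  have "z * w i' = w i" using w1 by (simp add: z_def mult_ac)
  moreover have "w i \<noteq> w i'" using bij i by (auto simp: bij_betw_def inj_on_def)
  ultimately have "z \<noteq> 1" by auto
  moreover have "z ^ N = 1"
    using wN i by (simp add: z_def power_mult_distrib flip: complex_cnj_power)
  ultimately have "(\<Sum>j<N. z ^ j) = 0"
    by (simp add: sum_gp_strict)
  then show ?thesis by (simp add: z_def w_def power_mult_distrib)
qed

subsection \<open>Steiner frames\<close>

lemma axial_steiner_etf:
  fixes h :: "nat \<Rightarrow> nat \<Rightarrow> 'a :: normed_conjugatable_field"
  assumes D: "is_bibd v k V B" and P: "is_parallel_class V B P"
  defines "r \<equiv> (v - 1) div (k - 1)"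
  assumes h1: "\<And>i j. i \<le> r \<Longrightarrow> j \<le> r \<Longrightarrow> norm (h i j) = 1"
    and h0: "\<And>j. j \<le> r \<Longrightarrow> h 0 j = 1"
    and rows: "\<And>i i'. i \<le> r \<Longrightarrow> i' \<le> r \<Longrightarrow> i \<noteq> i' \<Longrightarrow> (\<Sum>j\<le>r. h i j * conjugate (h i' j)) = 0"
  shows "\<exists>\<phi>s :: 'a vec list. length \<phi>s = v * (r + 1) \<and> is_axial_etf (card B) \<phi>s"
proof -
  have fV: "finite V" and cV: "card V = v" and k: "2 \<le> k" "k < v"
    and BV: "\<And>\<beta>. \<beta> \<in> B \<Longrightarrow> \<beta> \<subseteq> V" and cB: "\<And>\<beta>. \<beta> \<in> B \<Longrightarrow> card \<beta> = k"
    and U: "\<And>x y. x \<in> V \<Longrightarrow> y \<in> V \<Longrightarrow> x \<noteq> y \<Longrightarrow> \<exists>!\<beta>. \<beta> \<in> B \<and> x \<in> \<beta> \<and> y \<in> \<beta>"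
    using D unfolding is_bibd_def by blast+
  have "B \<subseteq> Pow V" using BV by blast
  then have fB: "finite B" using fV by (meson finite_Pow_iff finite_subset)
  have PB: "P \<subseteq> B" and part: "partition_on V P" using P by (auto simp: is_parallel_class_def)
  have cols: "(\<Sum>i\<le>r. h i j * conjugate (h i j')) = 0" if "j \<le> r" "j' \<le> r" "j \<noteq> j'" for j j'
    using hadamard_columns_orthogonal[of "Suc r" h j j'] h1 rows that
    by (simp add: lessThan_Suc_atMost less_Suc_eq_le)
  have r: "r > 0" using k by (simp add: r_def div_greater_zero_iff)
  define Bx where "Bx = (\<lambda>x. {\<beta> \<in> B. x \<in> \<beta>})"
  have fBx: "finite (Bx x)" for x using fB by (simp add: Bx_def)
  have cBx: "card (Bx x) = r" if "x \<in> V" for x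
    using is_bibd_replication_number(1)[OF D that] by (simp add: r_def Bx_def)
  have ex_p: "\<exists>\<beta>. \<beta> \<in> P \<and> x \<in> \<beta>" if "x \<in> V" for x
    using part that by (auto simp: partition_on_def)
  have "\<exists>t. bij_betw t (Bx x) {..<r} \<and> (\<forall>\<beta>\<in>P. x \<in> \<beta> \<longrightarrow> t \<beta> = 0)" if x: "x \<in> V" for x
  proof -
    obtain \<beta> where \<beta>: "\<beta> \<in> P" "x \<in> \<beta>" using ex_p[OF x] by blast
    obtain f where f: "bij_betw f (Bx x) {..<r}"
      using finite_same_card_bij[OF fBx, of "{..<r}" x] cBx[OF x] by auto
    have "f \<beta> < r" using f \<beta> PB by (auto simp: Bx_def dest: bij_betwE)
    then have "bij_betw (transpose (f \<beta>) 0 \<circ> f) (Bx x) {..<r}"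
      using f r by (intro bij_betw_trans[OF f]) auto
    moreover have "\<gamma> = \<beta>" if "\<gamma> \<in> P" "x \<in> \<gamma>" for \<gamma>
      using part \<beta> that by (auto simp: partition_on_def disjoint_def)
    ultimately show ?thesis by (intro exI[of _ "transpose (f \<beta>) 0 \<circ> f"]) auto
  qed
  then obtain t where t: "\<And>x. x \<in> V \<Longrightarrow> bij_betw (t x) (Bx x) {..<r}"
    and tP: "\<And>x \<beta>. x \<in> V \<Longrightarrow> \<beta> \<in> P \<Longrightarrow> x \<in> \<beta> \<Longrightarrow> t x \<beta> = 0"
    by metis
  have tr: "t x \<beta> < r" if "x \<in> V" "\<beta> \<in> B" "x \<in> \<beta>" for x \<beta>
    using t[OF that(1)] that by (auto simp: Bx_def dest: bij_betwE)
  have t_eq: "t x \<beta> \<noteq> t x \<gamma>" if "x \<in> V" "\<beta> \<in> B" "x \<in> \<beta>" "\<gamma> \<in> B" "x \<in> \<gamma>" "\<beta> \<noteq> \<gamma>" for x \<beta> \<gamma>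
    using t[OF that(1)] that by (auto simp: Bx_def bij_betw_def inj_on_def)
  define s where "s = (of_real (1 / sqrt (real r)) :: 'a)"
  have ss: "s * s = of_real (1 / real r)"
    unfolding s_def by (simp flip: of_real_mult)
  have cs: "conjugate s = s" by (simp only: s_def conjugate_of_real)
  have ns: "(norm s)\<^sup>2 = 1 / real r" by (simp add: s_def power_divide norm_divide)
  have s_mult: "s * u * conjugate (s * w) = of_real (1 / real r) * (u * conjugate w)" for u w
    unfolding ss[symmetric] by (simp add: conjugate_dist_mul cs mult_ac)
  define \<phi> where "\<phi> = (\<lambda>(x, j) \<beta>. if x \<in> \<beta> then s * h (t x \<beta>) j else 0)"
  have \<phi>_mult: "\<phi> (x, j) \<beta> * conjugate (\<phi> (y, j') \<gamma>)
    = (if x \<in> \<beta> \<and> y \<in> \<gamma> then of_real (1 / real r) * (h (t x \<beta>) j * conjugate (h (t y \<gamma>) j')) else 0)"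
    for x j y j' \<beta> \<gamma>
    by (simp add: \<phi>_def s_mult del: of_real_divide)
  define I where "I = V \<times> {..r}"
  have sumI: "(\<Sum>i\<in>I. g i) = (\<Sum>x\<in>V. \<Sum>j\<le>r. g (x, j))" for g :: "'b \<times> nat \<Rightarrow> 'a"
    by (simp add: I_def sum.cartesian_product)
  have sumB: "(\<Sum>\<beta>\<in>B. if x \<in> \<beta> then g (t x \<beta>) else 0) = (\<Sum>i<r. g i)" if "x \<in> V"
    for x and g :: "nat \<Rightarrow> 'c :: comm_monoid_add"
  proof -
    have "(\<Sum>\<beta>\<in>B. if x \<in> \<beta> then g (t x \<beta>) else 0) = (\<Sum>\<beta>\<in>Bx x. g (t x \<beta>))"
      using fB by (simp add: sum.inter_filter Bx_def)
    also have "\<dots> = (\<Sum>i<r. g i)" by (rule sum.reindex_bij_betw[OF t[OF that]])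
    finally show ?thesis .
  qed
  have "\<exists>\<phi>s :: 'a vec list. length \<phi>s = card I \<and> is_axial_etf (card B) \<phi>s"
  proof (rule axial_etf_of_family)
    show "finite I" using fV by (simp add: I_def)
    show "finite B" by fact
  next
    fix i assume "i \<in> I"
    then obtain x j where i: "i = (x, j)" "x \<in> V" "j \<le> r" by (auto simp: I_def)
    have "(\<Sum>\<beta>\<in>B. (norm (\<phi> i \<beta>))\<^sup>2) = (\<Sum>\<beta>\<in>B. if x \<in> \<beta> then 1 / real r else 0)"
      using tr i by (intro sum.cong) (auto simp: \<phi>_def norm_mult h1 less_imp_le ns)
    also have "\<dots> = 1" using r sumB[OF i(2), of "\<lambda>_. 1 / real r"] by simp
    finally show "(\<Sum>\<beta>\<in>B. (norm (\<phi> i \<beta>))\<^sup>2) = 1" .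
  next
    fix i i' assume "i \<in> I" "i' \<in> I" and neq: "i \<noteq> i'"
    then obtain x j y j' where i: "i = (x, j)" "x \<in> V" "j \<le> r" and i': "i' = (y, j')" "y \<in> V" "j' \<le> r"
      by (auto simp: I_def)
    show "norm (\<Sum>\<beta>\<in>B. \<phi> i \<beta> * conjugate (\<phi> i' \<beta>)) = 1 / real r"
    proof (cases "x = y")
      case True
      then have "j \<noteq> j'" using neq i i' by simp
      then have "(\<Sum>l<r. h l j * conjugate (h l j')) = - (h r j * conjugate (h r j'))"
        using cols[of j j'] i i' by (simp add: lessThan_Suc_atMost[symmetric] eq_neg_iff_add_eq_0)
      moreover have "(\<Sum>\<beta>\<in>B. \<phi> i \<beta> * conjugate (\<phi> i' \<beta>))
        = (\<Sum>l<r. of_real (1 / real r) * (h l j * conjugate (h l j')))"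
        unfolding sumB[OF i(2), of "\<lambda>l. of_real (1 / real r) * (h l j * conjugate (h l j'))", symmetric]
        by (simp only: i i' True \<phi>_mult conj_absorb)
      then have "(\<Sum>\<beta>\<in>B. \<phi> i \<beta> * conjugate (\<phi> i' \<beta>))
        = of_real (1 / real r) * (\<Sum>l<r. h l j * conjugate (h l j'))"
        by (simp only: sum_distrib_left)
      ultimately show ?thesis using i i' h1 by (simp add: norm_mult norm_divide)
    next
      case False
      then obtain \<beta> where \<beta>: "\<beta> \<in> B" "x \<in> \<beta>" "y \<in> \<beta>"
        and uniq: "\<And>\<gamma>. \<gamma> \<in> B \<Longrightarrow> x \<in> \<gamma> \<Longrightarrow> y \<in> \<gamma> \<Longrightarrow> \<gamma> = \<beta>"
        using U[of x y] i i' by blast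
      have "(\<Sum>\<gamma>\<in>B. \<phi> i \<gamma> * conjugate (\<phi> i' \<gamma>)) = (\<Sum>\<gamma>\<in>{\<beta>}. \<phi> i \<gamma> * conjugate (\<phi> i' \<gamma>))"
      proof (rule sum.mono_neutral_right[OF fB])
        show "\<forall>\<gamma>\<in>B - {\<beta>}. \<phi> i \<gamma> * conjugate (\<phi> i' \<gamma>) = 0"
        proof
          fix \<gamma> assume "\<gamma> \<in> B - {\<beta>}"
          then have "\<not> (x \<in> \<gamma> \<and> y \<in> \<gamma>)" using uniq by blast
          then show "\<phi> i \<gamma> * conjugate (\<phi> i' \<gamma>) = 0" by (simp only: i i' \<phi>_mult if_False)
        qed
      qed (use \<beta> in simp)
      then show ?thesis
        using \<beta> tr[OF i(2) \<beta>(1,2)] tr[OF i'(2) \<beta>(1,3)] i i'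
        by (simp add: \<phi>_mult norm_mult norm_divide h1)
    qed
  next
    show "real k * (real r + 1) / real r > 0" using k r by simp
  next
    fix \<beta> \<gamma> assume \<beta>: "\<beta> \<in> B" and \<gamma>: "\<gamma> \<in> B"
    have inner: "(\<Sum>j\<le>r. \<phi> (x, j) \<beta> * conjugate (\<phi> (x, j) \<gamma>))
      = (if x \<in> \<beta> \<and> \<beta> = \<gamma> then of_real ((real r + 1) / real r) else 0)" if "x \<in> V" for x
    proof -
      have "(\<Sum>j\<le>r. h (t x \<beta>) j * conjugate (h (t x \<gamma>) j)) = (if \<beta> = \<gamma> then of_nat (r + 1) else 0)"
        if x: "x \<in> \<beta>" "x \<in> \<gamma>"
        using rows[of "t x \<beta>" "t x \<gamma>"] t_eq[OF \<open>x \<in> V\<close> \<beta> x(1) \<gamma> x(2)]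
          tr[OF \<open>x \<in> V\<close> \<beta> x(1)] tr[OF \<open>x \<in> V\<close> \<gamma> x(2)]
        by (simp add: mult_conjugate_unit h1)
      then have *: "of_real (1 / real r) * (\<Sum>j\<le>r. h (t x \<beta>) j * conjugate (h (t x \<gamma>) j))
        = (if \<beta> = \<gamma> then of_real ((real r + 1) / real r) else 0)" if "x \<in> \<beta>" "x \<in> \<gamma>"
        using that by (simp add: add.commute)
      show ?thesis
      proof (cases "x \<in> \<beta> \<and> x \<in> \<gamma>")
        case True
        then show ?thesis using * by (simp add: \<phi>_mult sum_distrib_left del: of_real_divide)
      next
        case False
        then show ?thesis by (auto simp: \<phi>_mult)
      qed
    qed
    have "(\<Sum>i\<in>I. \<phi> i \<beta> * conjugate (\<phi> i \<gamma>))
      = (\<Sum>x\<in>V. if x \<in> \<beta> \<and> \<beta> = \<gamma> then of_real ((real r + 1) / real r) else 0)"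
      unfolding sumI by (intro sum.cong inner) auto
    also have "\<dots> = (if \<beta> = \<gamma> then \<Sum>x\<in>\<beta>. of_real ((real r + 1) / real r) else 0)"
      using fV BV[OF \<beta>] by (simp add: sum.inter_restrict[symmetric] Int_absorb1)
    also have "\<dots> = (if \<beta> = \<gamma> then of_real (real k * (real r + 1) / real r) else 0)"
      using cB[OF \<beta>] by auto
    finally show "(\<Sum>i\<in>I. \<phi> i \<beta> * conjugate (\<phi> i \<gamma>))
      = (if \<beta> = \<gamma> then of_real (real k * (real r + 1) / real r) else 0)" .
  next
    fix i assume "i \<in> I"
    then obtain x j where i: "i = (x, j)" "x \<in> V" "j \<le> r" by (auto simp: I_def)
    obtain \<beta> where \<beta>: "\<beta> \<in> P" "x \<in> \<beta>" using ex_p[OF i(2)] by blast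
    have uniq: "x \<notin> \<gamma>" if "\<gamma> \<in> P" "\<gamma> \<noteq> \<beta>" for \<gamma>
      using part \<beta> that by (auto simp: partition_on_def disjoint_def)
    have "(\<Sum>\<gamma>\<in>B. conjugate (\<phi> i \<gamma>) * (if \<gamma> \<in> P then of_real (sqrt r) else 0))
      = (\<Sum>\<gamma>\<in>{\<beta>}. conjugate (\<phi> i \<gamma>) * of_real (sqrt r))"
      using \<beta> uniq fB PB by (intro sum.mono_neutral_cong_right) (auto simp: i \<phi>_def)
    also have "\<dots> = 1"
      using \<beta> r by (simp add: i \<phi>_def tP h0 conjugate_dist_mul cs) (simp add: s_def)
    finally show "(\<Sum>\<gamma>\<in>B. conjugate (\<phi> i \<gamma>) * (if \<gamma> \<in> P then of_real (sqrt r) else 0)) = 1" .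
  qed
  then show ?thesis by (simp add: I_def card_cartesian_product cV)
qed

theorem theorem3p6:
  fixes v k r b :: nat and V :: "'p set" and B P :: "'p set set"
  defines "r \<equiv> (v - 1) div (k - 1)"
    and "b \<equiv> (v * (v - 1)) div (k * (k - 1))"
  assumes "2 \<le> k" and "k < v"
    and "is_bibd v k V B"
    and "is_parallel_class V B P"
  shows "(\<exists>\<phi>s :: complex vec list. length \<phi>s = v * (r + 1) \<and> is_axial_etf b \<phi>s) \<and>
         ((\<exists>H. is_real_hadamard (r + 1) H) \<longrightarrow>
            (\<exists>\<phi>s :: real vec list. length \<phi>s = v * (r + 1) \<and> is_axial_etf b \<phi>s))"
proof (intro conjI impI)
  have b: "card B = b" using is_bibd_number_of_blocks(1)[OF assms(5)] by (simp add: b_def)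
  show "\<exists>\<phi>s :: complex vec list. length \<phi>s = v * (r + 1) \<and> is_axial_etf b \<phi>s"
    unfolding b[symmetric]
  proof (rule axial_steiner_etf[OF assms(5,6), folded r_def,
        where h = "\<lambda>i j. cis (2 * pi * real i / real (Suc r)) ^ j"])
    show "(\<Sum>j\<le>r. cis (2 * pi * real i / real (Suc r)) ^ j *
      conjugate (cis (2 * pi * real i' / real (Suc r)) ^ j)) = 0" if "i \<le> r" "i' \<le> r" "i \<noteq> i'" for i i'
      using fourier_rows_orthogonal[of i "Suc r" i'] that by (simp add: lessThan_Suc_atMost)
  qed (simp_all add: norm_power)
next
  have b: "card B = b" using is_bibd_number_of_blocks(1)[OF assms(5)] by (simp add: b_def)
  assume "\<exists>H. is_real_hadamard (r + 1) H"
  then obtain H where had: "is_real_hadamard (Suc r) H" by auto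
  have H: "H \<in> carrier_mat (Suc r) (Suc r)" using had by (simp add: is_real_hadamard_def)
  have pm: "H $$ (i, j) = 1 \<or> H $$ (i, j) = -1" if "i \<le> r" "j \<le> r" for i j
    using had that by (simp add: is_real_hadamard_def)
  have orth: "row H i \<bullet> row H i' = 0" if "i \<le> r" "i' \<le> r" "i \<noteq> i'" for i i'
    using had that by (simp add: is_real_hadamard_def)
  have sq: "H $$ (0, j) * H $$ (0, j) = 1" if "j \<le> r" for j using pm[of 0 j] that by auto
  show "\<exists>\<phi>s :: real vec list. length \<phi>s = v * (r + 1) \<and> is_axial_etf b \<phi>s"
    unfolding b[symmetric]
    \<comment> \<open>Flipping the signs of columns makes the first row constant.\<close>
  proof (rule axial_steiner_etf[OF assms(5,6), folded r_def,
        where h = "\<lambda>i j. H $$ (i, j) * H $$ (0, j)"])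
    show "norm (H $$ (i, j) * H $$ (0, j)) = 1" if "i \<le> r" "j \<le> r" for i j
      using pm[OF that] pm[of 0 j] that by (auto simp: abs_mult)
    show "H $$ (0, j) * H $$ (0, j) = 1" if "j \<le> r" for j by (rule sq[OF that])
    show "(\<Sum>j\<le>r. H $$ (i, j) * H $$ (0, j) * conjugate (H $$ (i', j) * H $$ (0, j))) = 0"
      if i: "i \<le> r" "i' \<le> r" "i \<noteq> i'" for i i'
    proof -
      have "(\<Sum>j\<le>r. H $$ (i, j) * H $$ (0, j) * conjugate (H $$ (i', j) * H $$ (0, j)))
        = (\<Sum>j\<le>r. H $$ (i, j) * H $$ (i', j) * (H $$ (0, j) * H $$ (0, j)))"
        by (simp add: mult_ac)
      also have "\<dots> = (\<Sum>j\<le>r. H $$ (i, j) * H $$ (i', j))" by (simp add: sq)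
      also have "\<dots> = row H i \<bullet> row H i'"
        using i H by (simp add: scalar_prod_def atLeast0LessThan lessThan_Suc_atMost less_Suc_eq_le)
      finally show ?thesis using orth[OF i] by simp
    qed
  qed
qed

end
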